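(* Let $k\ge 2$ be an integer, $\Delta$ a finite set, and $f:\mathbb N\to\Delta$ a $k$-automatic sequence, identified with the right-infinite word $\mathbf w=f(0)f(1)f(2)\cdots$ over $\Delta$. Then the Lie complexity function $(L_{\mathbf w}(n))_{n\ge 0}$ is a $k$-automatic sequence.
   Context: A sequence $(s_n)_{n\ge0}$ is $k$-automatic if there is a deterministic finite automaton with output which, on input the base-$k$ representation of $n$, ends in a state whose output is $s_n$. A factor of $\mathbf w$ is a finite block of contiguous symbols (empty word included); $\mathrm{Fac}(\mathbf w)$ is the set of factors. Two words are cyclically equivalent if each is a cyclic shift of the other; $[v]_C$ is the class of $v$. The Lie complexity is $L_{\mathbf w}(n)=\#\{[v]_C : |v|=n,\ [v]_C\subseteq \mathrm{Fac}(\mathbf w)\}$. *)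

theory Defs
  imports Main
begin

function digits_lsd :: "nat \<Rightarrow> nat \<Rightarrow> nat list" where
  "digits_lsd k n = (if k < 2 \<or> n = 0 then [] else n mod k # digits_lsd k (n div k))"
  by auto
termination
  by (relation "measure snd") auto

definition base_rep :: "nat \<Rightarrow> nat \<Rightarrow> nat list" where
  "base_rep k n = rev (digits_lsd k n)"

definition k_automatic :: "nat \<Rightarrow> (nat \<Rightarrow> 'a) \<Rightarrow> bool" where
  "k_automatic k s \<longleftrightarrow>
     (\<exists>(Q :: nat set) q0 (delta :: nat \<Rightarrow> nat \<Rightarrow> nat) (tau :: nat \<Rightarrow> 'a).
        finite Q \<and> q0 \<in> Q \<and> (\<forall>q\<in>Q. \<forall>d<k. delta q d \<in> Q) \<and>
        (\<forall>n. s n = tau (foldl delta q0 (base_rep k n))))"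

definition Fac :: "(nat \<Rightarrow> 'a) \<Rightarrow> 'a list set" where
  "Fac f = {v. \<exists>i. v = map f [i..<i + length v]}"

definition cyc_class :: "'a list \<Rightarrow> 'a list set" where
  "cyc_class v = {rotate m v | m. True}"

definition lie_complexity :: "(nat \<Rightarrow> 'a) \<Rightarrow> nat \<Rightarrow> nat" where
  "lie_complexity f n = card {cyc_class v | v. length v = n \<and> cyc_class v \<subseteq> Fac f}"

end

theory Submission
  imports Defs
begin

text \<open>\<open>L(n)\<close> counts the positions \<open>i\<close> at which a class counted by \<open>L(n)\<close> has its first occurrence.
  This relation between \<open>i\<close> and \<open>n\<close> is first-order definable from addition and the values of \<open>f\<close>,
  hence automatic (Buechi), and so is \<open>L(n) \<ge> c\<close> for each constant \<open>c\<close>. It remains to see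
  that \<open>L\<close> is bounded. All factors of length \<open>n\<close> occur before position \<open>C n\<close>. Hence there are
  boundedly many classes with more than \<open>n / 4\<close> elements, and the words of any other class have a
  period of at most \<open>n / 4\<close>, so that by Fine--Wilf occurrences of two such classes are more than
  \<open>n / 4\<close> apart. This avoids Cassaigne's theorem on the first difference of the subword
  complexity.\<close>

section \<open>Automatic sequences as finite-index congruences for appending a digit\<close>

text \<open>Automata in Myhill-Nerode form: the values of \<open>key\<close> are the states, and
  reading \<open>d\<close> leads from the state of \<open>x\<close> to that of
  \<open>k * x + d\<close>. The value type is left free so that pairs and sets can serve as
  states.\<close>

definition digit_congruence :: "nat \<Rightarrow> (nat \<Rightarrow> 'b) \<Rightarrow> bool" where
  "digit_congruence k key \<longleftrightarrow> finite (range key) \<and>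
     (\<forall>x y d. d < k \<longrightarrow> key x = key y \<longrightarrow> key (k * x + d) = key (k * y + d))"

declare digits_lsd.simps [simp del]

lemma digit_congruenceD:
  assumes "digit_congruence k key" "d < k" "key x = key y"
  shows "key (k * x + d) = key (k * y + d)"
  using assms unfolding digit_congruence_def by blast

lemma base_rep_0 [simp]: "base_rep k 0 = []"
  by (simp add: base_rep_def digits_lsd.simps[of k 0])

lemma base_rep_step:
  assumes "k \<ge> 2" "n > 0"
  shows "base_rep k n = base_rep k (n div k) @ [n mod k]"
  using assms by (simp add: base_rep_def digits_lsd.simps[of k n])

lemma k_automatic_imp_digit_congruence:
  assumes k: "k \<ge> 2" and f: "k_automatic k f"
  obtains key :: "nat \<Rightarrow> bool \<times> nat"
  where "digit_congruence k key" "\<And>x y. key x = key y \<Longrightarrow> f x = f y"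
proof -
  obtain Q q0 delta tau where Q: "finite (Q :: nat set)" "q0 \<in> Q"
    and delta: "\<And>q d. q \<in> Q \<Longrightarrow> d < k \<Longrightarrow> delta q d \<in> Q"
    and f: "\<And>n. f n = tau (foldl delta q0 (base_rep k n))"
    using f unfolding k_automatic_def by blast
  define g where "g n = foldl delta q0 (base_rep k n)" for n
  have g: "g n = delta (g (n div k)) (n mod k)" if "n > 0" for n
    using base_rep_step[OF k that] by (simp add: g_def)
  have gQ: "g n \<in> Q" for n
  proof (induction n rule: less_induct)
    case (less n)
    show ?case
    proof (cases "n = 0")
      case True
      then show ?thesis using Q by (simp add: g_def)
    next
      case False
      then have "g (n div k) \<in> Q" using k by (intro less) auto
      then show ?thesis using False g[of n] delta[of "g (n div k)" "n mod k"] k by simp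
    qed
  qed
  \<comment> \<open>The automaton may leave its initial state on a leading zero, so zero is kept apart.\<close>
  define key where "key n = (n = 0, g n)" for n
  have "range key \<subseteq> UNIV \<times> Q" using gQ by (auto simp: key_def)
  then have fin: "finite (range key)" by (rule finite_subset) (simp add: Q(1))
  have step: "key (k * x + d) = key (k * y + d)" if d: "d < k" and xy: "key x = key y" for x y d
  proof (cases "x = 0")
    case True
    then show ?thesis using xy by (simp add: key_def)
  next
    case False
    moreover from this have "y \<noteq> 0" using xy by (simp add: key_def)
    ultimately show ?thesis using d xy k g[of "k * x + d"] g[of "k * y + d"]
      by (simp add: key_def)
  qed
  show thesis
  proof (rule that)
    show "digit_congruence k key"
      using fin step unfolding digit_congruence_def by blast
    show "f x = f y" if "key x = key y" for x y
      using that by (simp add: key_def f flip: g_def)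
  qed
qed

text \<open>The classes of \<open>key\<close> become the states; by the congruence, a transition
  does not depend on the number chosen to represent its state.\<close>

lemma digit_congruence_imp_k_automatic:
  fixes key :: "nat \<Rightarrow> 'b"
  assumes k: "k \<ge> 2" and key: "digit_congruence k key"
    and f: "\<And>x y. key x = key y \<Longrightarrow> f x = f y"
  shows "k_automatic k f"
proof -
  have "finite (range key)" using key by (simp add: digit_congruence_def)
  \<comment> \<open>\<open>k_automatic\<close> asks for states that are natural numbers.\<close>
  then obtain enc :: "'b \<Rightarrow> nat" where enc: "inj_on enc (range key)"
    using finite_imp_inj_to_nat_seg by blast
  define st where "st x = enc (key x)" for x
  have st: "key x = key y" if "st x = st y" for x y
    using that enc by (auto simp: st_def inj_on_def)
  define rp where "rp q = (SOME x. st x = q)" for q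
  have rp: "key (rp (st x)) = key x" for x
    unfolding rp_def by (rule st, rule someI) (rule refl)
  define delta where "delta q d = st (k * rp q + d)" for q d
  have step: "delta (st x) d = st (k * x + d)" if "d < k" for x d
    using digit_congruenceD[OF key that rp] by (simp add: delta_def st_def)
  have run: "foldl delta (st 0) (base_rep k n) = st n" for n
  proof (induction n rule: less_induct)
    case (less n)
    show ?case
    proof (cases "n = 0")
      case False
      then have "foldl delta (st 0) (base_rep k (n div k)) = st (n div k)"
        using k by (intro less) auto
      then show ?thesis using False base_rep_step[of k n] k step[of "n mod k" "n div k"] by simp
    qed simp
  qed
  have "finite (range st)"
    using finite_imageI[OF \<open>finite (range key)\<close>, of enc] by (simp add: st_def image_image)
  moreover have "\<forall>q\<in>range st. \<forall>d<k. delta q d \<in> range st"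
    by (auto simp: delta_def)
  moreover have "f n = f (rp (foldl delta (st 0) (base_rep k n)))" for n
    using f[OF rp[of n]] by (simp add: run)
  ultimately show ?thesis
    unfolding k_automatic_def
    by (intro exI[of _ "range st"] exI[of _ "st 0"] exI[of _ delta] exI[of _ "\<lambda>q. f (rp q)"]) auto
qed

section \<open>Recognizable predicates and their closure under first-order operations\<close>

text \<open>A predicate on tuples of numbers, here on environments, is recognized by an automaton reading
  least significant digits first iff its kernel is finite. In this form quantification
  needs no padding with leading zeros.\<close>

definition recognizable :: "nat \<Rightarrow> ((nat \<Rightarrow> nat) \<Rightarrow> bool) \<Rightarrow> bool" where
  "recognizable k R \<longleftrightarrow> (\<exists>F. finite F \<and> R \<in> F \<and>
     (\<forall>A\<in>F. \<forall>r. (\<forall>i. r i < k) \<longrightarrow> (\<lambda>e. A (\<lambda>i. k * e i + r i)) \<in> F))"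

lemma recognizableI:
  assumes "finite F" "R \<in> F"
    and "\<And>A r. A \<in> F \<Longrightarrow> (\<And>i. r i < k) \<Longrightarrow> (\<lambda>e. A (\<lambda>i. k * e i + r i)) \<in> F"
  shows "recognizable k R"
  using assms unfolding recognizable_def by blast

lemma recognizableE:
  assumes "recognizable k R"
  obtains F where "finite F" "R \<in> F"
    "\<And>A r. A \<in> F \<Longrightarrow> (\<And>i. r i < k) \<Longrightarrow> (\<lambda>e. A (\<lambda>i. k * e i + r i)) \<in> F"
  using assms unfolding recognizable_def by blast

lemma recognizable_const: "recognizable k (\<lambda>e. b)"
  by (rule recognizableI[of "{\<lambda>e. b}"]) auto

lemma recognizable_not:
  assumes "recognizable k R"
  shows "recognizable k (\<lambda>e. \<not> R e)"
proof -
  obtain F where F: "finite F" "R \<in> F"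
    "\<And>A r. A \<in> F \<Longrightarrow> (\<And>i. r i < k) \<Longrightarrow> (\<lambda>e. A (\<lambda>i. k * e i + r i)) \<in> F"
    by (rule recognizableE[OF assms]) blast
  show ?thesis
    by (rule recognizableI[of "(\<lambda>A e. \<not> A e) ` F"]) (use F in auto)
qed

lemma recognizable_conj:
  assumes "recognizable k R" "recognizable k S"
  shows "recognizable k (\<lambda>e. R e \<and> S e)"
proof -
  obtain F where F: "finite F" "R \<in> F"
    "\<And>A r. A \<in> F \<Longrightarrow> (\<And>i. r i < k) \<Longrightarrow> (\<lambda>e. A (\<lambda>i. k * e i + r i)) \<in> F"
    by (rule recognizableE[OF assms(1)]) blast
  obtain G where G: "finite G" "S \<in> G"
    "\<And>A r. A \<in> G \<Longrightarrow> (\<And>i. r i < k) \<Longrightarrow> (\<lambda>e. A (\<lambda>i. k * e i + r i)) \<in> G"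
    by (rule recognizableE[OF assms(2)]) blast
  show ?thesis
  proof (rule recognizableI[of "(\<lambda>(A, B) e. A e \<and> B e) ` (F \<times> G)"])
    show "finite ((\<lambda>(A, B) e. A e \<and> B e) ` (F \<times> G))" using F(1) G(1) by simp
    show "(\<lambda>e. R e \<and> S e) \<in> (\<lambda>(A, B) e. A e \<and> B e) ` (F \<times> G)"
      by (rule image_eqI[of _ _ "(R, S)"]) (use F(2) G(2) in auto)
    fix C r assume "C \<in> (\<lambda>(A, B) e. A e \<and> B e) ` (F \<times> G)" and r: "\<And>i :: nat. r i < k"
    then obtain A B where AB: "C = (\<lambda>e. A e \<and> B e)" "A \<in> F" "B \<in> G" by auto
    show "(\<lambda>e. C (\<lambda>i. k * e i + r i)) \<in> (\<lambda>(A, B) e. A e \<and> B e) ` (F \<times> G)"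
      by (rule image_eqI[of _ _ "(\<lambda>e. A (\<lambda>i. k * e i + r i), \<lambda>e. B (\<lambda>i. k * e i + r i))"])
        (use AB F(3) G(3) r in auto)
  qed
qed

lemma recognizable_imp:
  assumes "recognizable k R" "recognizable k S"
  shows "recognizable k (\<lambda>e. R e \<longrightarrow> S e)"
  using recognizable_not[OF recognizable_conj[OF assms(1) recognizable_not[OF assms(2)]]] by simp

lemma recognizable_rename:
  assumes "recognizable k R"
  shows "recognizable k (\<lambda>e. R (\<lambda>i. e (\<sigma> i)))"
proof -
  obtain F where F: "finite F" "R \<in> F"
    "\<And>A r. A \<in> F \<Longrightarrow> (\<And>i. r i < k) \<Longrightarrow> (\<lambda>e. A (\<lambda>i. k * e i + r i)) \<in> F"
    by (rule recognizableE[OF assms]) blast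
  show ?thesis
  proof (rule recognizableI[of "(\<lambda>A e. A (\<lambda>i. e (\<sigma> i))) ` F"])
    show "(\<lambda>e. R (\<lambda>i. e (\<sigma> i))) \<in> (\<lambda>A e. A (\<lambda>i. e (\<sigma> i))) ` F"
      by (rule rev_image_eqI[OF F(2)]) (rule refl)
    fix B r assume "B \<in> (\<lambda>A e. A (\<lambda>i. e (\<sigma> i))) ` F" and r: "\<And>i :: nat. r i < k"
    then obtain A where A: "A \<in> F" "B = (\<lambda>e. A (\<lambda>i. e (\<sigma> i)))" by auto
    \<comment> \<open>Reading the digits \<open>r\<close> after renaming amounts to reading the
      digits \<open>r (\<sigma> i)\<close> before it.\<close>
    have "(\<lambda>e. A (\<lambda>i. k * e i + r (\<sigma> i))) \<in> F"
      by (rule F(3)[OF A(1), of "\<lambda>i. r (\<sigma> i)"]) (rule r)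
    then show "(\<lambda>e. B (\<lambda>i. k * e i + r i)) \<in> (\<lambda>A e. A (\<lambda>i. e (\<sigma> i))) ` F"
      unfolding A(2) by (rule rev_image_eqI) simp
  qed (simp add: F(1))
qed

text \<open>Environments are de Bruijn style: a quantifier binds variable 0 and shifts the others.\<close>

lemma recognizable_ex:
  assumes k: "k > 0" and "recognizable k (\<lambda>p. Q (p 0) (\<lambda>i. p (Suc i)))"
  shows "recognizable k (\<lambda>e. \<exists>y. Q y e)"
proof -
  let ?R = "\<lambda>p. Q (p 0) (\<lambda>i. p (Suc i))"
  obtain F where F: "finite F" "?R \<in> F"
    "\<And>A r. A \<in> F \<Longrightarrow> (\<And>i. r i < k) \<Longrightarrow> (\<lambda>e. A (\<lambda>i. k * e i + r i)) \<in> F"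
    by (rule recognizableE[OF assms(2)]) blast
  \<comment> \<open>Subset construction: the digits of \<open>y\<close> are guessed, and
    \<open>S\<close> collects the kernel elements reachable under some guess.\<close>
  define ex where "ex S = (\<lambda>e. \<exists>y. \<exists>A\<in>S. A (case_nat y e))" for S :: "((nat \<Rightarrow> nat) \<Rightarrow> bool) set"
  show ?thesis
  proof (rule recognizableI[of "ex ` Pow F"])
    show "finite (ex ` Pow F)" using F(1) by simp
    show "(\<lambda>e. \<exists>y. Q y e) \<in> ex ` Pow F"
      by (rule image_eqI[of _ _ "{?R}"]) (use F(2) in \<open>auto simp: ex_def\<close>)
    fix B r assume "B \<in> ex ` Pow F" and r: "\<And>i :: nat. r i < k"
    then obtain S where S: "S \<subseteq> F" "B = ex S" by auto
    define step where "step A s = (\<lambda>e. A (\<lambda>i. k * e i + case_nat s r i))"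
      for A :: "(nat \<Rightarrow> nat) \<Rightarrow> bool" and s
    \<comment> \<open>One reading step, over all choices \<open>s\<close> of the next digit of
      \<open>y\<close>.\<close>
    define T where "T = {step A s | A s. A \<in> S \<and> s < k}"
    have "step A s \<in> F" if "A \<in> S" "s < k" for A s
      unfolding step_def using S that r by (intro F(3)) (auto split: nat.split)
    then have T: "T \<subseteq> F" by (auto simp: T_def)
    have env: "step A s (case_nat y e) = A (case_nat (k * y + s) (\<lambda>i. k * e i + r i))" for A s y e
      unfolding step_def by (rule arg_cong[of _ _ A]) (auto split: nat.split)
    have "(\<lambda>e. B (\<lambda>i. k * e i + r i)) = ex T"
    proof (intro ext iffI)
      fix e assume "B (\<lambda>i. k * e i + r i)"
      then obtain y A where A: "A \<in> S" "A (case_nat y (\<lambda>i. k * e i + r i))"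
        by (auto simp: S ex_def)
      then have "step A (y mod k) (case_nat (y div k) e)" by (simp add: env)
      moreover have "step A (y mod k) \<in> T"
        unfolding T_def using A k mod_less_divisor[OF k, of y] by blast
      ultimately show "ex T e" by (auto simp: ex_def)
    next
      fix e assume "ex T e"
      then obtain y A s where "A \<in> S" "step A s (case_nat y e)"
        by (auto simp: ex_def T_def)
      then show "B (\<lambda>i. k * e i + r i)" unfolding S ex_def env by blast
    qed
    then show "(\<lambda>e. B (\<lambda>i. k * e i + r i)) \<in> ex ` Pow F" using T by auto
  qed
qed

lemma recognizable_all:
  assumes "k > 0" "recognizable k (\<lambda>p. Q (p 0) (\<lambda>i. p (Suc i)))"
  shows "recognizable k (\<lambda>e. \<forall>y. Q y e)"
  using recognizable_not[OF recognizable_ex[OF assms(1) recognizable_not[OF assms(2)]]] by simp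

text \<open>Column addition: \<open>P 0\<close> and \<open>P 1\<close> are addition with incoming
  carry 0 and 1, and the constantly false predicate is entered once a digit of the sum is
  wrong.\<close>

lemma recognizable_add: "recognizable k (\<lambda>e. e i + e j = e l)"
proof -
  define P where "P c = (\<lambda>e :: nat \<Rightarrow> nat. e i + e j + c = e l)" for c
  show ?thesis
  proof (rule recognizableI[of "{\<lambda>e. False, P 0, P 1}"])
    fix A r assume A: "A \<in> {\<lambda>e. False, P 0, P 1}" and r: "\<And>i :: nat. r i < k"
    have "(\<lambda>e. P c (\<lambda>i. k * e i + r i)) \<in> {\<lambda>e. False, P 0, P 1}" if "c \<le> 1" for c
    proof -
      \<comment> \<open>\<open>s mod k\<close> is the digit due in this column,
        \<open>s div k\<close> the outgoing carry.\<close>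
      define s where "s = r i + r j + c"
      have "k > 0" using r[of i] by simp
      have "s < k * 2" using r[of i] r[of j] that by (simp add: s_def)
      then have "s div k < 2" using \<open>k > 0\<close> by (simp add: less_mult_imp_div_less mult.commute)
      then have c: "s div k = 0 \<or> s div k = 1" by linarith
      have P: "P c (\<lambda>i. k * e i + r i) \<longleftrightarrow> k * (e i + e j + s div k) + s mod k = k * e l + r l" for e
        by (simp add: P_def s_def algebra_simps)
      have "k * a + s mod k = k * b + r l \<longleftrightarrow> a = b \<and> s mod k = r l" for a b
      proof
        assume "k * a + s mod k = k * b + r l"
        then have "(k * a + s mod k) div k = (k * b + r l) div k"
          "(k * a + s mod k) mod k = (k * b + r l) mod k" by simp_all
        then show "a = b \<and> s mod k = r l" using r[of l] \<open>k > 0\<close> by simp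
      qed simp
      then have "(\<lambda>e. P c (\<lambda>i. k * e i + r i)) = (if s mod k = r l then P (s div k) else (\<lambda>e. False))"
        unfolding P by (auto simp: P_def)
      then show ?thesis using c by auto
    qed
    from this[of 0] this[of 1] show "(\<lambda>e. A (\<lambda>i. k * e i + r i)) \<in> {\<lambda>e. False, P 0, P 1}"
      using A by auto
  qed (auto simp: P_def)
qed

lemma recognizable_le:
  assumes "k > 0"
  shows "recognizable k (\<lambda>e. e i \<le> e j)"
proof -
  have "recognizable k (\<lambda>e. \<exists>y. e i + y = e j)"
    by (rule recognizable_ex[OF assms]) (rule recognizable_add)
  then show ?thesis by (simp add: le_iff_add eq_commute)
qed

lemma recognizable_less:
  assumes "k > 0"
  shows "recognizable k (\<lambda>e. e i < e j)"
  using recognizable_not[OF recognizable_le[OF assms, of j i]] by (simp add: not_le)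

text \<open>\<open>key\<close> works from the most significant digit, a kernel strips the least
  significant one. So the family consists of tests whether a pair of keys lies in a set
  \<open>S\<close>; stripping digits replaces \<open>S\<close> by its preimage under appending
  them.\<close>

lemma recognizable_eq_value:
  assumes "k \<ge> 2" "k_automatic k f"
  shows "recognizable k (\<lambda>e. f (e i) = f (e j))"
proof -
  obtain key :: "nat \<Rightarrow> bool \<times> nat" where key: "digit_congruence k key"
    and f: "\<And>x y. key x = key y \<Longrightarrow> f x = f y"
    using k_automatic_imp_digit_congruence[OF assms] by blast
  define test where "test S = (\<lambda>e. (key (e i), key (e j)) \<in> S)" for S
  show ?thesis
  proof (rule recognizableI[of "test ` Pow (range key \<times> range key)"])
    show "finite (test ` Pow (range key \<times> range key))"
      using key by (simp add: digit_congruence_def)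
    have "(\<lambda>e. f (e i) = f (e j)) = test {(key x, key y) | x y. f x = f y}"
      unfolding test_def by (rule ext) (auto, metis f)
    then show "(\<lambda>e. f (e i) = f (e j)) \<in> test ` Pow (range key \<times> range key)" by auto
    fix A r assume "A \<in> test ` Pow (range key \<times> range key)" and r: "\<And>i :: nat. r i < k"
    then obtain S where S: "A = test S" by auto
    have cong: "key (k * x + r l) = key (k * y + r l)" if "key x = key y" for x y l
      using digit_congruenceD[OF key r that] .
    have "(\<lambda>e. A (\<lambda>i. k * e i + r i)) =
        test {(key x, key y) | x y. (key (k * x + r i), key (k * y + r j)) \<in> S}" (is "?L = test ?T")
      unfolding S test_def
    proof (intro ext iffI)
      fix e assume "(key (e i), key (e j)) \<in> ?T"
      then obtain x y where "key (e i) = key x" "key (e j) = key y"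
        "(key (k * x + r i), key (k * y + r j)) \<in> S" by auto
      then show "(key (k * e i + r i), key (k * e j + r j)) \<in> S"
        using cong[of "e i" x i] cong[of "e j" y j] by simp
    qed auto
    then show "(\<lambda>e. A (\<lambda>i. k * e i + r i)) \<in> test ` Pow (range key \<times> range key)" by auto
  qed
qed

text \<open>For a fixed \<open>c\<close> this is a first-order statement: the elements are chosen in
  increasing order, and the induction splits off the minimum.\<close>

lemma recognizable_card_ge:
  assumes k: "k > 0" and "recognizable k (\<lambda>p. Q (p 0) (\<lambda>i. p (Suc i)))"
  shows "recognizable k (\<lambda>e. \<exists>S. finite S \<and> card S = c \<and> (\<forall>y\<in>S. Q y e))"
  using assms(2)
proof (induction c arbitrary: Q)
  case 0
  have "(\<lambda>e. \<exists>S. finite S \<and> card S = 0 \<and> (\<forall>y\<in>S. Q y e)) = (\<lambda>e. True)"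
    by (rule ext) (simp, rule exI[of _ "{}"], simp)
  then show ?case using recognizable_const by simp
next
  case (Suc c)
  have eq: "(\<exists>S. finite S \<and> card S = Suc c \<and> (\<forall>y\<in>S. Q y e)) \<longleftrightarrow>
      (\<exists>y. Q y e \<and> (\<exists>S. finite S \<and> card S = c \<and> (\<forall>z\<in>S. Q z e \<and> y < z)))" for e
  proof
    assume "\<exists>S. finite S \<and> card S = Suc c \<and> (\<forall>y\<in>S. Q y e)"
    then obtain S where S: "finite S" "card S = Suc c" "\<forall>y\<in>S. Q y e" by blast
    then have "S \<noteq> {}" by auto
    then have "Min S \<in> S" using S by simp
    moreover have "Min S < z" if "z \<in> S - {Min S}" for z
      using that S Min_le[of S z] by (auto simp: le_less)
    ultimately show "\<exists>y. Q y e \<and> (\<exists>S. finite S \<and> card S = c \<and> (\<forall>z\<in>S. Q z e \<and> y < z))"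
      using S by (intro exI[of _ "Min S"] conjI exI[of _ "S - {Min S}"]) auto
  next
    assume "\<exists>y. Q y e \<and> (\<exists>S. finite S \<and> card S = c \<and> (\<forall>z\<in>S. Q z e \<and> y < z))"
    then obtain y S where S: "Q y e" "finite S" "card S = c" "\<forall>z\<in>S. Q z e \<and> y < z" by blast
    then have "y \<notin> S" by auto
    then show "\<exists>S. finite S \<and> card S = Suc c \<and> (\<forall>y\<in>S. Q y e)"
      using S by (intro exI[of _ "insert y S"]) auto
  qed
  show ?case
    unfolding eq
  proof (intro recognizable_ex k recognizable_conj Suc.prems)
    show "recognizable k (\<lambda>p. \<exists>S. finite S \<and> card S = c \<and> (\<forall>z\<in>S. Q z (\<lambda>i. p (Suc i)) \<and> p 0 < z))"
    proof (rule Suc.IH, rule recognizable_conj)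
      show "recognizable k (\<lambda>p. Q (p 0) (\<lambda>i. p (Suc (Suc i))))"
        \<comment> \<open>Variable 0 is \<open>z\<close> and variable 1 is the split-off minimum,
          which the renaming skips.\<close>
        using recognizable_rename[OF Suc.prems, of "case_nat 0 (\<lambda>i. Suc (Suc i))"] by simp
    qed (rule recognizable_less[OF k])
  qed
qed

section \<open>From recognizable predicates back to automatic sequences\<close>

text \<open>Boundedness leaves finitely many level sets, so finitely many finite closed families
  combine into one finite set of states.\<close>

lemma k_automatic_if_recognizable_values:
  assumes k: "k \<ge> 2" and bound: "\<And>n. g n \<le> B"
    and rec: "\<And>c. recognizable k (\<lambda>e. g (e 0) = c)"
  shows "k_automatic k (g :: nat \<Rightarrow> nat)"
proof -
  have "\<forall>c. \<exists>F. finite F \<and> (\<lambda>e :: nat \<Rightarrow> nat. g (e 0) = c) \<in> F \<and>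
     (\<forall>A\<in>F. \<forall>r. (\<forall>i. r i < k) \<longrightarrow> (\<lambda>e. A (\<lambda>i. k * e i + r i)) \<in> F)"
    by (intro allI rec[unfolded recognizable_def])
  from choice[OF this] obtain F :: "nat \<Rightarrow> ((nat \<Rightarrow> nat) \<Rightarrow> bool) set" where
    F: "\<And>c. finite (F c)" "\<And>c. (\<lambda>e. g (e 0) = c) \<in> F c"
      "\<And>c A r. A \<in> F c \<Longrightarrow> (\<And>i. r i < k) \<Longrightarrow> (\<lambda>e. A (\<lambda>i. k * e i + r i)) \<in> F c"
    by blast
  define G where "G = (\<Union>c\<le>B. F c)"
  \<comment> \<open>This determinizes the reversed automaton: reading a most significant digit acts on the
    set of kernel elements satisfied so far.\<close>
  define key where "key n = {A \<in> G. A (\<lambda>_. n)}" for n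
  have "finite G" using F(1) by (simp add: G_def)
  moreover have "range key \<subseteq> Pow G" by (auto simp: key_def)
  ultimately have "finite (range key)" using finite_subset by blast
  moreover have "key (k * x + d) = key (k * y + d)" if "d < k" "key x = key y" for x y d
  proof -
    have "A (\<lambda>_. k * x + d) \<longleftrightarrow> A (\<lambda>_. k * y + d)" if "A \<in> G" for A
    proof -
      \<comment> \<open>Only constant environments occur in \<open>key\<close>, so every variable
        reads the same digit \<open>d\<close>.\<close>
      have "(\<lambda>e. A (\<lambda>i. k * e i + d)) \<in> G"
        using that F(3)[of A _ "\<lambda>_. d", OF _ \<open>d < k\<close>] unfolding G_def by blast
      then have "A (\<lambda>_. k * z + d) \<longleftrightarrow> (\<lambda>e. A (\<lambda>i. k * e i + d)) \<in> key z" for z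
        by (simp add: key_def)
      then show ?thesis using \<open>key x = key y\<close> by simp
    qed
    then show ?thesis by (auto simp: key_def)
  qed
  ultimately have "digit_congruence k key" unfolding digit_congruence_def by blast
  moreover have "g x = g y" if "key x = key y" for x y
  proof -
    have "(\<lambda>e. g (e 0) = g x) \<in> G" using F(2) bound by (auto simp: G_def)
    then have "(\<lambda>e. g (e 0) = g x) \<in> key x" by (simp add: key_def)
    then show ?thesis unfolding that by (simp add: key_def)
  qed
  ultimately show ?thesis using digit_congruence_imp_k_automatic[OF k] by blast
qed

lemma k_automatic_card:
  assumes k: "k \<ge> 2" and rec: "recognizable k (\<lambda>p. R (p 0) (p 1))"
    and fin: "\<And>n. finite {y. R y n}" and bound: "\<And>n. card {y. R y n} \<le> B"
  shows "k_automatic k (\<lambda>n. card {y. R y n})"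
proof (rule k_automatic_if_recognizable_values[OF k bound])
  fix c
  \<comment> \<open>\<open>fin\<close> matters here: an infinite set has \<open>card\<close> 0 but
    contains subsets of every finite size.\<close>
  have ge: "(\<exists>S. finite S \<and> card S = c \<and> (\<forall>y\<in>S. R y n)) \<longleftrightarrow> c \<le> card {y. R y n}" for c n
  proof
    assume "\<exists>S. finite S \<and> card S = c \<and> (\<forall>y\<in>S. R y n)"
    then show "c \<le> card {y. R y n}" using fin by (auto intro!: card_mono)
  next
    assume "c \<le> card {y. R y n}"
    then obtain S where "S \<subseteq> {y. R y n}" "card S = c" "finite S"
      by (rule obtain_subset_with_card_n)
    then show "\<exists>S. finite S \<and> card S = c \<and> (\<forall>y\<in>S. R y n)" by blast
  qed
  have "recognizable k (\<lambda>e. c \<le> card {y. R y (e 0)})" for c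
    using recognizable_card_ge[of k "\<lambda>y e. R y (e 0)" c] k rec by (simp add: ge)
  then have "recognizable k (\<lambda>e. c \<le> card {y. R y (e 0)} \<and> \<not> Suc c \<le> card {y. R y (e 0)})"
    by (intro recognizable_conj recognizable_not)
  moreover have "(c \<le> m \<and> \<not> Suc c \<le> m) = (m = c)" for m by auto
  ultimately show "recognizable k (\<lambda>e. card {y. R y (e 0)} = c)" by simp
qed

subsection \<open>Cyclic classes of factors\<close>

abbreviation window :: "(nat \<Rightarrow> 'a) \<Rightarrow> nat \<Rightarrow> nat \<Rightarrow> 'a list" where
  "window f n i \<equiv> map f [i..<i + n]"

lemma self_in_cyc_class: "v \<in> cyc_class v"
  by (auto simp: cyc_class_def intro: exI[of _ 0])

lemma rotate_inverse:
  obtains m' where "rotate m' (rotate m v) = v"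
proof -
  \<comment> \<open>The total rotation becomes a multiple of the length.\<close>
  obtain m' where "m + m' = length v * m" if "v \<noteq> []"
    by (cases v) (auto intro: that[of "(length v - 1) * m"])
  then show thesis
    by (intro that[of m'], cases "v = []") (simp_all add: rotate_rotate add.commute rotate_id)
qed

lemma cyc_class_eqI:
  fixes v w :: "'a list"
  assumes "w \<in> cyc_class v"
  shows "cyc_class w = cyc_class v"
proof -
  obtain m where m: "w = rotate m v" using assms by (auto simp: cyc_class_def)
  obtain m' where "rotate m' w = v" using rotate_inverse unfolding m by blast
  then have "v \<in> cyc_class w" by (auto simp: cyc_class_def)
  moreover have "cyc_class x \<subseteq> cyc_class y" if "x \<in> cyc_class y" for x y :: "'a list"
    using that by (auto simp: cyc_class_def rotate_rotate)
  ultimately show ?thesis using assms by blast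
qed

lemma length_cyc_class: "w \<in> cyc_class v \<Longrightarrow> length w = length v"
  by (auto simp: cyc_class_def)

text \<open>Rotating by \<open>t\<close> swaps the initial block of length \<open>t\<close> with the
  remaining block of length \<open>u\<close>. Writing the length as \<open>t + u\<close> keeps
  subtraction and remainders out of the formula to be recognized.\<close>

lemma window_eq_rotate_iff:
  "window f (t + u) j = rotate t (window f (t + u) i) \<longleftrightarrow>
   (\<forall>x<u. f (j + x) = f (i + t + x)) \<and> (\<forall>x<t. f (j + u + x) = f (i + x))"
proof -
  have split: "window f (a + b) i = window f a i @ window f b (i + a)" for a b i
    using upt_add_eq_append[of i "i + a" b] by (simp add: add.assoc)
  have rot: "rotate t (window f (t + u) i) = window f u (i + t) @ window f t i"
    using rotate_append[of "window f t i" "window f u (i + t)"] by (simp add: split)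
  have j: "window f (t + u) j = window f u j @ window f t (j + u)"
    using split[of j u t] by (simp add: add.commute)
  show ?thesis
    unfolding rot j by (subst append_eq_append_conv) (auto simp: list_eq_iff_nth_eq)
qed

lemma in_cyc_class_iff:
  assumes "length v = n"
  shows "w \<in> cyc_class v \<longleftrightarrow> (\<exists>t u. t + u = n \<and> w = rotate t v)"
proof
  assume "w \<in> cyc_class v"
  then obtain m where m: "w = rotate m v" by (auto simp: cyc_class_def)
  show "\<exists>t u. t + u = n \<and> w = rotate t v"
  proof (cases "n = 0")
    case True
    then show ?thesis using m assms by simp
  next
    case False
    then have "m mod n \<le> n" by simp
    then show ?thesis using m assms rotate_conv_mod[of m v]
      by (intro exI[of _ "m mod n"] exI[of _ "n - m mod n"]) auto
  qed
qed (auto simp: cyc_class_def)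

definition first_in_class :: "(nat \<Rightarrow> 'a) \<Rightarrow> nat \<Rightarrow> nat \<Rightarrow> bool" where
  "first_in_class f i n \<longleftrightarrow> cyc_class (window f n i) \<subseteq> Fac f \<and>
     (\<forall>j<i. window f n i \<notin> cyc_class (window f n j))"

text \<open>A class is represented by the least position at which any of its members occurs. Of two
  positions sharing a class, the larger one is excluded by the smaller.\<close>

lemma lie_classes_bij:
  "bij_betw (\<lambda>i. cyc_class (window f n i)) {i. first_in_class f i n}
     {cyc_class v | v. length v = n \<and> cyc_class v \<subseteq> Fac f}"
  unfolding bij_betw_def
proof
  show "inj_on (\<lambda>i. cyc_class (window f n i)) {i. first_in_class f i n}"
  proof (rule inj_onI, rule ccontr)
    fix i j assume *: "i \<in> {i. first_in_class f i n}" "j \<in> {i. first_in_class f i n}"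
      "cyc_class (window f n i) = cyc_class (window f n j)" "i \<noteq> j"
    then have "window f n i \<in> cyc_class (window f n j)" "window f n j \<in> cyc_class (window f n i)"
      using self_in_cyc_class by blast+
    then show False using * by (auto simp: first_in_class_def neq_iff)
  qed
  show "(\<lambda>i. cyc_class (window f n i)) ` {i. first_in_class f i n} =
      {cyc_class v | v. length v = n \<and> cyc_class v \<subseteq> Fac f}"
  proof (intro equalityI subsetI)
    fix c assume "c \<in> {cyc_class v | v. length v = n \<and> cyc_class v \<subseteq> Fac f}"
    then obtain v where v: "c = cyc_class v" "length v = n" "cyc_class v \<subseteq> Fac f" by auto
    then have "v \<in> Fac f" using self_in_cyc_class by blast
    then obtain i0 where "v = window f n i0" using v by (auto simp: Fac_def)
    then have ex: "window f n i0 \<in> cyc_class v" using self_in_cyc_class by simp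
    define i where "i = (LEAST i. window f n i \<in> cyc_class v)"
    have i: "window f n i \<in> cyc_class v" unfolding i_def by (rule LeastI[of _ i0]) (rule ex)
    then have eq: "cyc_class (window f n i) = c" using cyc_class_eqI v by blast
    have "window f n i \<notin> cyc_class (window f n j)" if "j < i" for j
    proof
      assume "window f n i \<in> cyc_class (window f n j)"
      then have "cyc_class (window f n j) = cyc_class v" using cyc_class_eqI eq v by blast
      then show False using not_less_Least[OF that[unfolded i_def]] self_in_cyc_class by blast
    qed
    then have "first_in_class f i n" using eq v by (auto simp: first_in_class_def)
    then show "c \<in> (\<lambda>i. cyc_class (window f n i)) ` {i. first_in_class f i n}" using eq by auto
  next
    fix c assume "c \<in> (\<lambda>i. cyc_class (window f n i)) ` {i. first_in_class f i n}"
    then obtain i where "c = cyc_class (window f n i)" "first_in_class f i n" by auto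
    then show "c \<in> {cyc_class v | v. length v = n \<and> cyc_class v \<subseteq> Fac f}"
      by (intro CollectI exI[of _ "window f n i"]) (auto simp: first_in_class_def)
  qed
qed

lemma recognizable_first_in_class:
  assumes k: "k \<ge> 2" and f: "k_automatic k f"
  shows "recognizable k (\<lambda>p. first_in_class f (p 0) (p 1))"
proof -
  have k0: "k > 0" using k by simp
  have value_add: "recognizable k (\<lambda>e. f (e a + e x) = f (e b + e x))" for a b x
  proof -
    \<comment> \<open>Atomic formulas mention only variables, so each sum is named by a quantified
      variable.\<close>
    have "recognizable k (\<lambda>e. \<exists>p. e a + e x = p \<and> (\<exists>q. e b + e x = q \<and> f p = f q))"
      by (intro recognizable_ex recognizable_conj k0 recognizable_add recognizable_eq_value[OF k f])
    then show ?thesis by simp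
  qed
  have same: "recognizable k (\<lambda>e. \<forall>x. x < e u \<longrightarrow> f (e a + x) = f (e b + x))" for a b u
    by (intro recognizable_all recognizable_imp k0 recognizable_less value_add)
  have rot: "recognizable k (\<lambda>e. \<exists>p. e i + e t = p \<and> (\<exists>q. e j + e u = q \<and>
      (\<forall>x. x < e u \<longrightarrow> f (e j + x) = f (p + x)) \<and> (\<forall>x. x < e t \<longrightarrow> f (q + x) = f (e i + x))))"
    for i j t u
    by (intro recognizable_ex recognizable_conj k0 recognizable_add same)
  define rotation where "rotation i j t u \<longleftrightarrow> window f (t + u) j = rotate t (window f (t + u) i)"
    for i j t u
  have rotation: "recognizable k (\<lambda>e. rotation (e i) (e j) (e t) (e u))" for i j t u
    using rot[of i t j u] by (simp add: rotation_def window_eq_rotate_iff add.assoc)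
  have in_class: "window f n j \<in> cyc_class (window f n i) \<longleftrightarrow> (\<exists>t u. t + u = n \<and> rotation i j t u)"
    for n i j by (auto simp: in_cyc_class_iff rotation_def)
  have "cyc_class (window f n i) \<subseteq> Fac f \<longleftrightarrow> (\<forall>t u. t + u = n \<longrightarrow> (\<exists>j. rotation i j t u))" for n i
  proof -
    have "cyc_class (window f n i) \<subseteq> Fac f \<longleftrightarrow>
        (\<forall>t u. t + u = n \<longrightarrow> rotate t (window f n i) \<in> Fac f)"
      by (auto simp: subset_iff in_cyc_class_iff[of "window f n i" n])
    moreover have "rotate t (window f (t + u) i) \<in> Fac f \<longleftrightarrow> (\<exists>j. rotation i j t u)" for t u
      unfolding Fac_def rotation_def mem_Collect_eq length_rotate length_map length_upt
        diff_add_inverse by (subst eq_commute) (rule refl)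
    ultimately show ?thesis by metis
  qed
  then have "first_in_class f i n \<longleftrightarrow> (\<forall>t u. t + u = n \<longrightarrow> (\<exists>j. rotation i j t u)) \<and>
      (\<forall>j. j < i \<longrightarrow> \<not> (\<exists>t u. t + u = n \<and> rotation j i t u))" for i n
    by (auto simp: first_in_class_def in_class)
  then show ?thesis
    by (auto intro!: recognizable_conj recognizable_all recognizable_ex recognizable_imp
      recognizable_not k0 recognizable_add recognizable_less rotation)
qed

subsection \<open>Boundedness of the Lie complexity\<close>

lemma digit_congruence_power:
  assumes k: "k \<ge> 2" and key: "digit_congruence k key" and "key x = key y"
  shows "r < k ^ m \<Longrightarrow> key (k ^ m * x + r) = key (k ^ m * y + r)"
proof (induction m arbitrary: r)
  case 0
  then show ?case using assms by simp
next
  case (Suc m)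
  have "r div k < k ^ m" using Suc.prems k by (simp add: less_mult_imp_div_less mult.commute)
  then have "key (k ^ m * x + r div k) = key (k ^ m * y + r div k)" by (rule Suc.IH)
  then have "key (k * (k ^ m * x + r div k) + r mod k) = key (k * (k ^ m * y + r div k) + r mod k)"
    using k by (intro digit_congruenceD[OF key]) auto
  then show ?case by (simp add: algebra_simps)
qed

text \<open>Cut the sequence into blocks of length \<open>k ^ m\<close> with
  \<open>n \<le> k ^ m \<le> k * n\<close>. A window of length \<open>n\<close> meets at most two
  consecutive blocks \<open>x\<close> and \<open>Suc x\<close>, whose contents depend only on the
  keys of their indices. As there are finitely many pairs of keys, some \<open>y < J\<close> can
  replace \<open>x\<close>.\<close>

lemma first_occurrence_linear:
  assumes k: "k \<ge> 2" and f: "k_automatic k f"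
  obtains C where "\<And>n i. n > 0 \<Longrightarrow> \<exists>j<C * n. window f n j = window f n i"
proof -
  obtain key :: "nat \<Rightarrow> bool \<times> nat" where key: "digit_congruence k key"
    and f: "\<And>x y. key x = key y \<Longrightarrow> f x = f y"
    using k_automatic_imp_digit_congruence[OF assms] by blast
  define key2 where "key2 x = (key x, key (Suc x))" for x
  have "range key2 \<subseteq> range key \<times> range key" by (auto simp: key2_def)
  then have fin: "finite (range key2)"
    by (rule finite_subset)
      (intro finite_cartesian_product key[unfolded digit_congruence_def, THEN conjunct1])
  \<comment> \<open>\<open>J\<close> exceeds one chosen representative of each pair of keys.\<close>
  define J where "J = Suc (Max ((\<lambda>q. SOME x. key2 x = q) ` range key2))"
  have J: "\<exists>y<J. key2 y = key2 x" for x
  proof -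
    let ?y = "SOME y. key2 y = key2 x"
    have "?y \<le> Max ((\<lambda>q. SOME x. key2 x = q) ` range key2)" using fin by (intro Max_ge) auto
    moreover have "key2 ?y = key2 x" by (rule someI) (rule refl)
    ultimately show ?thesis unfolding J_def by (intro exI[of _ ?y]) simp
  qed
  show thesis
  proof (rule that[of "J * k"])
    fix n i :: nat assume n: "n > 0"
    have "\<exists>m. n \<le> k ^ m" using k less_exp[of n] power_mono[of 2 k n] by (intro exI[of _ n]) linarith
    define m where "m = (LEAST m. n \<le> k ^ m)"
    have m: "n \<le> k ^ m" unfolding m_def using \<open>\<exists>m. n \<le> k ^ m\<close> by (rule LeastI_ex)
    have kn: "k ^ m \<le> k * n"
    proof (cases m)
      case 0
      then show ?thesis using k n by simp
    next
      case (Suc m')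
      then have "\<not> n \<le> k ^ m'" using not_less_Least[of m' "\<lambda>m. n \<le> k ^ m"] by (simp add: m_def)
      then show ?thesis using Suc by simp
    qed
    define x r where "x = i div k ^ m" and "r = i mod k ^ m"
    have i: "i = k ^ m * x + r" and r: "r < k ^ m" using k by (auto simp: x_def r_def)
    obtain y where y: "y < J" "key2 y = key2 x" using J by blast
    define j where "j = k ^ m * y + r"
    have "j < k ^ m * Suc y" using r by (simp add: j_def)
    also have "\<dots> \<le> k ^ m * J" using y by (intro mult_le_mono) auto
    also have "\<dots> \<le> k * n * J" using kn by (rule mult_le_mono1)
    finally have "j < J * k * n" by (simp add: mult_ac)
    moreover have "f (j + z) = f (i + z)" if z: "z < n" for z
    proof (cases "r + z < k ^ m")
      case True
      then have "key (k ^ m * y + (r + z)) = key (k ^ m * x + (r + z))"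
        using y by (intro digit_congruence_power[OF k key]) (simp_all add: key2_def)
      then show ?thesis by (intro f) (simp add: i j_def add.assoc)
    next
      case False
      \<comment> \<open>The position has passed into the next block; as
        \<open>n \<le> k ^ m\<close>, it goes no further.\<close>
      then have "key (k ^ m * Suc y + (r + z - k ^ m)) = key (k ^ m * Suc x + (r + z - k ^ m))"
        using y r z m by (intro digit_congruence_power[OF k key]) (simp_all add: key2_def)
      then show ?thesis using False by (intro f) (simp add: i j_def algebra_simps)
    qed
    ultimately show "\<exists>j<J * k * n. window f n j = window f n i"
      by (intro exI[of _ j]) (auto simp: list_eq_iff_nth_eq)
  qed
qed

text \<open>Pigeonhole: among the rotations by \<open>0\<close> to \<open>m\<close> two coincide,
  and undoing the smaller one leaves the difference as a period.\<close>

lemma small_class_period: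
  assumes "card (cyc_class v) \<le> m"
  obtains p where "0 < p" "p \<le> m" "rotate p v = v"
proof -
  have "\<not> inj_on (\<lambda>r. rotate r v) {..m}"
  proof
    assume "inj_on (\<lambda>r. rotate r v) {..m}"
    moreover have "finite (cyc_class v)"
    proof (rule finite_subset)
      show "cyc_class v \<subseteq> (\<lambda>t. rotate t v) ` {..length v}"
        by (auto simp: in_cyc_class_iff[OF refl])
    qed simp
    ultimately have "card {..m} \<le> card (cyc_class v)"
      by (intro card_inj_on_le[of "\<lambda>r. rotate r v"]) (auto simp: cyc_class_def)
    then show False using assms by simp
  qed
  then obtain a b where ab: "a < b" "b \<le> m" "rotate a v = rotate b v"
    unfolding inj_on_def by (metis atMost_iff nat_neq_iff)
  have eq: "rotate a (rotate (b - a) v) = rotate a v"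
    using ab by (simp add: rotate_rotate)
  obtain m' where m': "rotate m' (rotate a v) = v" by (rule rotate_inverse)
  have "rotate (b - a) v = rotate (b - a) (rotate m' (rotate a v))" by (simp only: m')
  also have "\<dots> = rotate m' (rotate a (rotate (b - a) v))" by (simp add: rotate_rotate add_ac)
  also have "\<dots> = v" by (simp only: eq m')
  finally have "rotate (b - a) v = v" .
  then show thesis using ab that[of "b - a"] by simp
qed

text \<open>Fine--Wilf, without the gcd: on an overlap of length \<open>p + q\<close> the sequence \<open>a\<close> inherits the
  period \<open>q\<close> of \<open>b\<close>, so both are determined by a common block of length \<open>q\<close>.\<close>

lemma periodic_overlap_eq:
  fixes a b :: "nat \<Rightarrow> 'a"
  assumes a: "\<And>x. a (x + p) = a x" and b: "\<And>x. b (x + q) = b x"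
    and ab: "\<And>x. x < p + q \<Longrightarrow> a x = b x" and pq: "p > 0" "q > 0"
  shows "a x = b x"
proof -
  have period: "g x = g (x mod d)" if "\<And>x. g (x + d) = g x" for g :: "nat \<Rightarrow> 'a" and d x
  proof -
    have "g (y + d * m) = g y" for y m
      by (induction m) (simp_all add: that add.left_commute flip: add.assoc, metis that add.commute add.assoc)
    from this[of "x mod d" "x div d"] show ?thesis by simp
  qed
  have "a (x + q) = a x" for x
  proof -
    \<comment> \<open>Both \<open>x mod p\<close> and \<open>x mod p + q\<close> lie below
      \<open>p + q\<close>, where \<open>a\<close> and \<open>b\<close> agree.\<close>
    have "a (x mod p + q) = b (x mod p)" using ab pq b by (simp add: add_strict_right_mono)
    also have "\<dots> = a (x mod p)" using ab pq by (simp add: trans_less_add1)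
    finally have "a (x mod p + q) = a (x mod p)" .
    then show ?thesis using period[of a p, OF a] by (metis mod_add_left_eq)
  qed
  then have "a x = a (x mod q)" by (rule period)
  also have "\<dots> = b (x mod q)" using ab pq by (simp add: trans_less_add2)
  also have "\<dots> = b x" using period[of b q, OF b] by simp
  finally show ?thesis .
qed

text \<open>Both windows have cyclic periods of at most \<open>n div 4\<close> and are shifted by at
  most \<open>n div 4\<close>, so their overlap is long enough for
  \<open>periodic_overlap_eq\<close>. Hence one window is the rotation of the other by
  \<open>d\<close>.\<close>

lemma overlap_cyc_class_eq:
  assumes n: "n > 0" and ij: "i \<le> j" "j - i \<le> n div 4"
    and ci: "card (cyc_class (window f n i)) \<le> n div 4"
    and cj: "card (cyc_class (window f n j)) \<le> n div 4"
  shows "cyc_class (window f n i) = cyc_class (window f n j)"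
proof -
  let ?v = "window f n i" and ?w = "window f n j"
  define d where "d = j - i"
  obtain p where p: "0 < p" "p \<le> n div 4" "rotate p ?v = ?v" using small_class_period[OF ci] .
  obtain q where q: "0 < q" "q \<le> n div 4" "rotate q ?w = ?w" using small_class_period[OF cj] .
  have per: "u ! ((x + s) mod n) = u ! (x mod n)" if "rotate s u = u" "length u = n" for u :: "'a list" and s x
    using nth_rotate[of "x mod n" u s] that n by (simp add: add.commute mod_add_right_eq)
  \<comment> \<open>Reading the words cyclically yields infinite periodic sequences; the shift by
    \<open>d\<close> aligns them on the overlap.\<close>
  define a where "a x = ?v ! ((x + d) mod n)" for x
  define b where "b x = ?w ! (x mod n)" for x
  have "a x = b x" for x
  proof (rule periodic_overlap_eq)
    show "a (x + p) = a x" for x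
      using per[of p ?v "x + d"] p by (simp add: a_def add_ac)
    show "b (x + q) = b x" for x
      using per[of q ?w x] q by (simp add: b_def)
    show "a x = b x" if "x < p + q" for x
    proof -
      \<comment> \<open>Three summands of at most \<open>n div 4\<close> each, so the cyclic reading
        does not wrap around.\<close>
      have "x + d < n" using that p q ij n by (simp add: d_def)
      then show ?thesis using ij by (simp add: a_def b_def d_def add.commute)
    qed
  qed (use p q in auto)
  then have ab: "?w ! (x mod n) = ?v ! ((x + d) mod n)" for x by (simp add: a_def b_def)
  have "?w = rotate d ?v"
  proof (rule nth_equalityI)
    fix x assume "x < length ?w"
    then show "?w ! x = rotate d ?v ! x"
      using ab[of x] nth_rotate[of x ?v d] by (simp add: add.commute del: nth_map)
  qed simp
  then have "?w \<in> cyc_class ?v" by (auto simp: cyc_class_def)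
  then show ?thesis using cyc_class_eqI by metis
qed

text \<open>Classes of size more than \<open>n / 4\<close> are few because they are disjoint sets of the linearly many
  factors. The other classes have a short period, so nearby occurrences of two of them would overlap
  enough to coincide.\<close>

lemma lie_complexity_bounded:
  assumes occ: "\<And>n i. n > 0 \<Longrightarrow> \<exists>j<C * n. window f n j = window f n i"
  shows "finite {cyc_class v | v. length v = n \<and> cyc_class v \<subseteq> Fac f}" (is "finite (?K n)")
    and "lie_complexity f n \<le> 8 * C + 1"
proof -
  have "finite (?K n) \<and> lie_complexity f n \<le> 8 * C + 1"
  proof (cases "n = 0")
    case True
    have "?K n \<subseteq> {cyc_class []}" using True by auto
    then show ?thesis
      using card_mono[of "{cyc_class []}" "?K n"] finite_subset[of "?K n" "{cyc_class []}"]
      by (auto simp: lie_complexity_def)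
  next
    case False
    then have n: "n > 0" by simp
    define K where "K = ?K n"
    have word: "\<exists>j<C * n. v = window f n j" if "v \<in> Fac f" "length v = n" for v
      using that occ[OF n] by (auto simp: Fac_def) metis
    have class_eq: "c = cyc_class v" "length v = n" "v \<in> Fac f" if "c \<in> K" "v \<in> c" for c v
      using that unfolding K_def using cyc_class_eqI[of v] length_cyc_class[of v] by auto
    have ex: "\<exists>j. j < C * n \<and> c = cyc_class (window f n j)" if c: "c \<in> K" for c
    proof -
      obtain v where "c = cyc_class v" using c unfolding K_def by auto
      then have "v \<in> c" using self_in_cyc_class by simp
      then show ?thesis using class_eq[OF c] word by metis
    qed
    define pos where "pos c = (SOME j. j < C * n \<and> c = cyc_class (window f n j))" for c
    have pos: "pos c < C * n \<and> c = cyc_class (window f n (pos c))" if "c \<in> K" for c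
      unfolding pos_def by (rule someI_ex[OF ex[OF that]])
    have "K \<subseteq> (\<lambda>j. cyc_class (window f n j)) ` {..<C * n}" using pos by auto
    then have fin: "finite (K)" by (rule finite_subset) simp
    \<comment> \<open>With this \<open>m\<close>, both \<open>card c < m\<close> and a distance
      below \<open>m\<close> mean at most \<open>n div 4\<close>, while still
      \<open>n \<le> 4 * m\<close>.\<close>
    define m where "m = Suc (n div 4)"
    have m: "n \<le> 4 * m" "m > 0" by (auto simp: m_def)
    define K1 where "K1 = {c \<in> K. m \<le> card c}"
    define K2 where "K2 = {c \<in> K. card c < m}"
    have "card K1 \<le> 4 * C"
    proof -
      have sub: "\<Union>K1 \<subseteq> window f n ` {..<C * n}"
      proof
        fix v assume "v \<in> \<Union>K1"
        then obtain c where "c \<in> K" "v \<in> c" by (auto simp: K1_def)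
        then have "\<exists>j<C * n. v = window f n j" by (intro word class_eq[of c v])
        then show "v \<in> window f n ` {..<C * n}" by auto
      qed
      then have fin1: "finite (\<Union>K1)" by (rule finite_subset) simp
      have "m * card K1 \<le> (\<Sum>c\<in>K1. card c)"
        using sum_bounded_below[of K1 m card] by (simp add: K1_def mult.commute)
      also have "\<dots> = card (\<Union>K1)"
      proof (rule card_Union_disjoint[symmetric])
        show "pairwise disjnt K1"
          unfolding pairwise_def disjnt_def K1_def using class_eq(1) by (metis (lifting) CollectD disjoint_iff)
        show "finite c" if "c \<in> K1" for c
          by (rule finite_subset[OF Union_upper[OF that] fin1])
      qed
      also have "\<dots> \<le> card (window f n ` {..<C * n})" using sub by (intro card_mono) auto
      also have "\<dots> \<le> C * n" using card_image_le[of "{..<C * n}" "window f n"] by simp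
      also have "\<dots> \<le> m * (4 * C)" using m(1) mult_le_mono2[of n "4 * m" C] by (simp add: mult_ac)
      finally show ?thesis using m(2) by simp
    qed
    moreover have "card K2 \<le> Suc (4 * C)"
    proof -
      \<comment> \<open>Positions with equal quotient by \<open>m\<close> are less than
        \<open>m\<close> apart, so each interval of length \<open>m\<close> holds at most one class
        of \<open>K2\<close>.\<close>
      have near: "c = c'" if "c \<in> K2" "c' \<in> K2" "pos c div m = pos c' div m" "pos c \<le> pos c'" for c c'
      proof -
        have "pos c' - pos c < m"
          using that(3,4) div_times_less_eq_dividend[of "pos c" m]
            dividend_less_div_times[OF m(2), of "pos c'"] by (simp add: less_diff_conv2)
        moreover have "c = cyc_class (window f n (pos c))" "c' = cyc_class (window f n (pos c'))"
          using pos that unfolding K2_def by blast+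
        ultimately show ?thesis
          using that overlap_cyc_class_eq[OF n, of "pos c" "pos c'" f]
          by (simp add: K2_def m_def less_Suc_eq_le)
      qed
      have "inj_on (\<lambda>c. pos c div m) K2"
        by (rule inj_onI) (metis near nle_le)
      moreover have "pos c div m \<le> 4 * C" if "c \<in> K2" for c
      proof -
        have "pos c \<le> C * n" using pos[of c] that unfolding K2_def by simp
        also have "\<dots> \<le> 4 * C * m" using m(1) mult_le_mono2[of n "4 * m" C] by (simp add: mult_ac)
        finally show ?thesis using m(2) div_le_mono[of "pos c" "4 * C * m" m] by simp
      qed
      ultimately have "card K2 \<le> card {..4 * C}" by (intro card_inj_on_le) auto
      then show ?thesis by simp
    qed
    moreover have "K = K1 \<union> K2" by (auto simp: K1_def K2_def)
    ultimately show ?thesis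
      using fin card_Un_le[of K1 K2] by (simp add: lie_complexity_def flip: K_def)
  qed
  then show "finite (?K n)" "lie_complexity f n \<le> 8 * C + 1" by auto
qed

theorem theorem4:
  fixes k :: nat and \<Delta> :: "'a set" and f :: "nat \<Rightarrow> 'a"
  assumes "k \<ge> 2" and "finite \<Delta>" and "range f \<subseteq> \<Delta>" and "k_automatic k f"
  shows "k_automatic k (lie_complexity f)"
proof -
  obtain C where C: "\<And>n i. n > 0 \<Longrightarrow> \<exists>j<C * n. window f n j = window f n i"
    using first_occurrence_linear[OF assms(1,4)] by blast
  have count: "lie_complexity f n = card {i. first_in_class f i n}" for n
    unfolding lie_complexity_def by (rule bij_betw_same_card[OF lie_classes_bij, symmetric])
  have "k_automatic k (\<lambda>n. card {i. first_in_class f i n})"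
  proof (rule k_automatic_card[OF assms(1) recognizable_first_in_class[OF assms(1,4)]])
    show "finite {i. first_in_class f i n}" for n
      using bij_betw_finite[OF lie_classes_bij] lie_complexity_bounded(1)[OF C] by blast
    show "card {i. first_in_class f i n} \<le> 8 * C + 1" for n
      using lie_complexity_bounded(2)[OF C] by (simp flip: count)
  qed
  moreover have "lie_complexity f = (\<lambda>n. card {i. first_in_class f i n})" using count by (rule ext)
  ultimately show ?thesis by simp
qed

end
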